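(* For every integer $k\ge 1$, $$h_k(x)=\sum_{i=0}^{k-1}\mathrm{Duck}_{k,i}\, x^i,$$ where $h_k(x)=f_k(x-1)$ and $f_k(x)=\sum_{i=0}^{k-1}|\mathrm{RedVHC}_k(\mathrm{Av}_{3k-i}(312))|\,x^i$.
   Context: $S_n$ is the set of permutations $\pi=\pi_1\cdots\pi_n$ of $\{1,\dots,n\}$. $\pi$ is $312$-avoiding if there are no indices $a<b<c$ with $\pi_b<\pi_c<\pi_a$; $\mathrm{Av}_n(312)\subseteq S_n$ is the set of $312$-avoiding permutations of length $n$. The plot of $\pi$ is the set of points $(i,\pi_i)$, $1\le i\le n$. If $\pi_i>\pi_{i+1}$, then $i$ is a descent, $(i,\pi_i)$ is a descent top and $(i+1,\pi_{i+1})$ is a descent bottom. A hook on $\pi$ from $(i,\pi_i)$ to $(j,\pi_j)$, where $i<j$ and $\pi_i<\pi_j$, consists of the vertical segment from $(i,\pi_i)$ up to $(i,\pi_j)$ followed by the horizontal segment from $(i,\pi_j)$ to $(j,\pi_j)$. The point $(i,\pi_i)$ is its southwest (SW) endpoint and $(j,\pi_j)$ its northeast (NE) endpoint. A valid hook configuration on $\pi$ is a set of hooks on $\pi$ such that: (i) the set of SW endpoints of the hooks is exactly the set of descent tops of $\pi$; (ii) no point of the plot lies directly above a hook (for a hook from $(i,\pi_i)$ to $(j,\pi_j)$ there is no $l$ with $i<l<j$ and $\pi_l>\pi_j$); (iii) distinct hooks do not intersect, except at endpoints (the NE endpoint of one hook may be the SW endpoint of another; two hooks sharing the same NE endpoint,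 or the same SW endpoint, overlap in a segment and are not allowed). It is reduced if every point of the plot is a hook endpoint or a descent bottom (or both). For a set $S$ of permutations, $\mathrm{RedVHC}_k(S)$ is the set of all reduced valid hook configurations with exactly $k$ hooks on permutations in $S$ (a configuration includes the data of its underlying permutation). A 3D-Dyck word of length $3k$ is a word with $k$ letters X, $k$ letters Y and $k$ letters Z such that in every prefix the number of X's is at least the number of Y's, which is at least the number of Z's. $\mathrm{Duck}_{k,i}$ is the number of 3D-Dyck words of length $3k$ in which exactly $i$ of the Y's do not have an X immediately before them. *)

theory Defs
  imports
    "HOL-Analysis.Analysis"
    "HOL-Computational_Algebra.Polynomial"
    "HOL-Combinatorics.Multiset_Permutations"
    "HOL-Library.Sublist"
begin

text \<open>Permutations of \<open>{1..n}\<close> are written in one-line notation, as elements of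
  \<^term>\<open>permutations_of_set {1..n}\<close>. Positions are counted from 1.\<close>

definition entry :: "nat list \<Rightarrow> nat \<Rightarrow> nat" where
  "entry p i = p ! (i - 1)"

definition avoids_312 :: "nat list \<Rightarrow> bool" where
  "avoids_312 p \<longleftrightarrow>
     \<not> (\<exists>a b c. 1 \<le> a \<and> a < b \<and> b < c \<and> c \<le> length p \<and>
         entry p b < entry p c \<and> entry p c < entry p a)"

definition Av_312 :: "nat \<Rightarrow> nat list set" where
  "Av_312 n = {p \<in> permutations_of_set {1..n}. avoids_312 p}"

type_synonym point = "nat \<times> nat"

definition plot :: "nat list \<Rightarrow> point set" where
  "plot p = {(i, entry p i) | i. 1 \<le> i \<and> i \<le> length p}"

definition descents :: "nat list \<Rightarrow> nat set" where
  "descents p = {i. 1 \<le> i \<and> i < length p \<and> entry p i > entry p (i + 1)}"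

definition descent_tops :: "nat list \<Rightarrow> point set" where
  "descent_tops p = (\<lambda>i. (i, entry p i)) ` descents p"

definition descent_bottoms :: "nat list \<Rightarrow> point set" where
  "descent_bottoms p = (\<lambda>i. (i + 1, entry p (i + 1))) ` descents p"

text \<open>A hook is given by its southwest and northeast endpoints, in this order.\<close>

type_synonym hook = "point \<times> point"

definition hooks :: "nat list \<Rightarrow> hook set" where
  "hooks p = {(s, t). s \<in> plot p \<and> t \<in> plot p \<and> fst s < fst t \<and> snd s < snd t}"

definition to_plane :: "point \<Rightarrow> real \<times> real" where
  "to_plane s = (real (fst s), real (snd s))"

definition hook_curve :: "hook \<Rightarrow> (real \<times> real) set" where
  "hook_curve h = (case h of (s, t) \<Rightarrow>
     closed_segment (to_plane s) (to_plane (fst s, snd t)) \<union>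
     closed_segment (to_plane (fst s, snd t)) (to_plane t))"

definition hook_endpoints :: "hook \<Rightarrow> point set" where
  "hook_endpoints h = {fst h, snd h}"

text \<open>Since the curves are subsets of the real plane, two distinct hooks with a common SW endpoint
  or a common NE endpoint share a segment of positive length, so the last condition excludes them.\<close>

definition valid_hook_configuration :: "nat list \<Rightarrow> hook set \<Rightarrow> bool" where
  "valid_hook_configuration p H \<longleftrightarrow>
     H \<subseteq> hooks p \<and>
     fst ` H = descent_tops p \<and>
     (\<forall>(s, t) \<in> H. \<not> (\<exists>r \<in> plot p. fst s < fst r \<and> fst r < fst t \<and> snd r > snd t)) \<and>
     (\<forall>h \<in> H. \<forall>h' \<in> H. h \<noteq> h' \<longrightarrow>
        hook_curve h \<inter> hook_curve h' \<subseteq> to_plane ` (hook_endpoints h \<inter> hook_endpoints h'))"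

definition reduced :: "nat list \<Rightarrow> hook set \<Rightarrow> bool" where
  "reduced p H \<longleftrightarrow> plot p \<subseteq> (\<Union>h\<in>H. hook_endpoints h) \<union> descent_bottoms p"

definition RedVHC :: "nat \<Rightarrow> nat list set \<Rightarrow> (nat list \<times> hook set) set" where
  "RedVHC k S = {(p, H). p \<in> S \<and> valid_hook_configuration p H \<and> reduced p H \<and> card H = k}"

datatype letter = LX | LY | LZ

definition dyck_words_3d :: "nat \<Rightarrow> letter list set" where
  "dyck_words_3d k = {w. count_list w LX = k \<and> count_list w LY = k \<and> count_list w LZ = k \<and>
     (\<forall>u. prefix u w \<longrightarrow> count_list u LX \<ge> count_list u LY \<and> count_list u LY \<ge> count_list u LZ)}"

definition Ys_not_after_X :: "letter list \<Rightarrow> nat set" where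
  "Ys_not_after_X w = {m. m < length w \<and> w ! m = LY \<and> \<not> (m > 0 \<and> w ! (m - 1) = LX)}"

definition Duck :: "nat \<Rightarrow> nat \<Rightarrow> nat" where
  "Duck k i = card {w \<in> dyck_words_3d k. card (Ys_not_after_X w) = i}"

definition f_poly :: "nat \<Rightarrow> int poly" where
  "f_poly k = (\<Sum>i = 0..k - 1. monom (int (card (RedVHC k (Av_312 (3 * k - i))))) i)"

definition h_poly :: "nat \<Rightarrow> int poly" where
  "h_poly k = pcompose (f_poly k) [:- 1, 1:]"

end

theory Submission imports Defs begin

text \<open>
  In a \<open>312\<close>-avoiding permutation every ascent ends in a left-to-right maximum, so the permutation
  is determined by its sequence of prefix maxima: each entry is the largest unused value below the
  current maximum. The hooks are determined by the set of their NE endpoints, because they match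
  descents with NE endpoints in a noncrossing way. A reduced configuration is thus a sequence of
  prefix maxima with some marked positions, which is cut into blocks of three kinds: a rise by
  \<open>d + 1\<close> followed by a descent (\<open>X\<^sup>d Y\<close>), a rise by \<open>d + 1\<close> to an NE endpoint
  (\<open>X\<^sup>d Z\<close>), and a lone descent (a marked \<open>Y\<close>, never after an \<open>X\<close>). Feasibility of the prefix
  maxima becomes the condition that \<open>X\<close> dominates \<open>Y\<close>, and existence of the matching the condition
  that \<open>Y\<close> dominates \<open>Z\<close>. Each mark shortens the permutation by one, so
  \<open>|RedVHC\<^sub>k(Av\<^sub>3\<^sub>k\<^sub>-\<^sub>i(312))| = \<Sum>\<^sub>j (j choose i) Duck\<^sub>k\<^sub>,\<^sub>j\<close>, that is, \<open>f\<^sub>k(x) = \<Sum>\<^sub>j Duck\<^sub>k\<^sub>,\<^sub>j (x + 1)\<^sup>j\<close>.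
\<close>

subsection \<open>3D-Dyck words\<close>

lemma count_list_eq_card: "count_list w x = card {i. i < length w \<and> w ! i = x}"
  by (simp add: count_list_eq_length_filter length_filter_conv_card eq_commute)

lemma finite_dyck_words_3d: "finite (dyck_words_3d k)"
proof (rule finite_subset)
  have *: "length w = count_list w LX + count_list w LY + count_list w LZ" for w
  proof (induction w)
    case (Cons l w)
    then show ?case by (cases l) auto
  qed simp
  have "UNIV = {LX, LY, LZ}"
    using letter.exhaust by blast
  then show "dyck_words_3d k \<subseteq> {w. set w \<subseteq> {LX, LY, LZ} \<and> length w = 3 * k}"
    by (auto simp: dyck_words_3d_def *)
  show "finite {w. set w \<subseteq> {LX, LY, LZ} \<and> length w = 3 * k}"
    by (intro finite_lists_length_eq) simp
qed

lemma finite_Ys_not_after_X [simp]: "finite (Ys_not_after_X w)"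
  by (rule finite_subset[of _ "{..<length w}"]) (auto simp: Ys_not_after_X_def)

text \<open>The first \<open>LY\<close> has no \<open>LZ\<close> before it, since \<open>LY\<close>
  dominates \<open>LZ\<close>, and some \<open>LX\<close> before it, since \<open>LX\<close>
  dominates \<open>LY\<close>. Hence it directly follows an \<open>LX\<close> and is not counted,
  which is why the exponents stop at \<open>k - 1\<close>.\<close>

lemma card_Ys_not_after_X_less:
  assumes "w \<in> dyck_words_3d k" "k \<ge> 1"
  shows "card (Ys_not_after_X w) < k"
proof -
  let ?Y = "{i. i < length w \<and> w ! i = LY}"
  have cY: "card ?Y = k" using assms by (auto simp: dyck_words_3d_def count_list_eq_card)
  then have "?Y \<noteq> {}" using assms(2) by (metis card.empty not_one_le_zero)
  then obtain m0 where "m0 \<in> ?Y" by blast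
  define m where "m = (LEAST i. i \<in> ?Y)"
  have m: "m \<in> ?Y" unfolding m_def using \<open>m0 \<in> ?Y\<close> by (rule LeastI)
  have below: "w ! i \<noteq> LY" if "i < m" for i
  proof
    assume "w ! i = LY"
    then have "i \<in> ?Y" using that m by auto
    then show False using that not_less_Least[of i "\<lambda>i. i \<in> ?Y"] m_def by simp
  qed
  have pre: "count_list (take j w) LX \<ge> count_list (take j w) LY"
    "count_list (take j w) LY \<ge> count_list (take j w) LZ" for j
    using assms(1) by (auto simp: dyck_words_3d_def take_is_prefix)
  have noY: "count_list (take m w) LY = 0"
    using below by (auto simp: count_list_0_iff in_set_conv_nth)
  have noZ: "w ! i \<noteq> LZ" if "i < m" for i
  proof -
    have "LZ \<notin> set (take m w)" using pre(2)[of m] noY by (simp add: count_list_0_iff)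
    then show ?thesis using that m by (force simp: in_set_conv_nth)
  qed
  have "count_list (take (Suc m) w) LY \<noteq> 0" using m by (simp add: take_Suc_conv_app_nth)
  then have "count_list (take (Suc m) w) LX \<noteq> 0" using pre(1)[of "Suc m"] by simp
  then have "LX \<in> set (take (Suc m) w)" by (simp add: count_list_0_iff)
  then have "m > 0" using m by (cases m) (auto simp: take_Suc_conv_app_nth)
  then have "w ! (m - 1) = LX" using below[of "m - 1"] noZ[of "m - 1"]
    by (cases "w ! (m - 1)") auto
  then have "m \<notin> Ys_not_after_X w" using \<open>m > 0\<close> by (simp add: Ys_not_after_X_def)
  moreover have "Ys_not_after_X w \<subseteq> ?Y" unfolding Ys_not_after_X_def by blast
  ultimately have "Ys_not_after_X w \<subset> ?Y" using m by blast
  then show ?thesis using cY psubset_card_mono[of ?Y] by simp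
qed

text \<open>The coefficient of \<open>x^i\<close> in \<open>(x + 1)^j\<close> counts the ways to
  mark \<open>i\<close> of \<open>j\<close> letters, so shifting the variable amounts to counting
  words with marks.\<close>

lemma card_marked_dyck_words:
  "card {(w, M). w \<in> dyck_words_3d k \<and> M \<subseteq> Ys_not_after_X w \<and> card M = i} =
     (\<Sum>w\<in>dyck_words_3d k. card (Ys_not_after_X w) choose i)"
proof -
  have "{(w, M). w \<in> dyck_words_3d k \<and> M \<subseteq> Ys_not_after_X w \<and> card M = i} =
    Sigma (dyck_words_3d k) (\<lambda>w. {M. M \<subseteq> Ys_not_after_X w \<and> card M = i})" by auto
  then show ?thesis by (simp add: card_SigmaI finite_dyck_words_3d n_subsets)
qed

text \<open>\<open>a\<close> and \<open>b\<close> are the current excesses of \<open>X\<close> over \<open>Y\<close> and of \<open>Y\<close> over \<open>Z\<close>; in \<open>marked_walk\<close>,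
  \<open>q\<close> tells whether the preceding letter is an \<open>X\<close>.\<close>

fun walk :: "nat \<Rightarrow> nat \<Rightarrow> letter list \<Rightarrow> bool" where
  "walk a b [] \<longleftrightarrow> a = 0 \<and> b = 0"
| "walk a b (LX # w) \<longleftrightarrow> walk (Suc a) b w"
| "walk a b (LY # w) \<longleftrightarrow> a > 0 \<and> walk (a - 1) (Suc b) w"
| "walk a b (LZ # w) \<longleftrightarrow> b > 0 \<and> walk a (b - 1) w"

lemma all_prefix_Cons: "(\<forall>u. prefix u (x # w) \<longrightarrow> P u) \<longleftrightarrow> P [] \<and> P [x] \<and> (\<forall>u. prefix u w \<longrightarrow> P (x # u))"
  by (auto simp: prefix_Cons)

lemma walk_iff:
  "walk a b w \<longleftrightarrow>
     (\<forall>u. prefix u w \<longrightarrow> count_list u LY \<le> a + count_list u LX \<and> count_list u LZ \<le> b + count_list u LY) \<and>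
     count_list w LY = a + count_list w LX \<and> count_list w LZ = b + count_list w LY"
proof (induction a b w rule: walk.induct)
  case (3 a b w)
  then show ?case by (cases a) (auto simp: all_prefix_Cons)
next
  case (4 a b w)
  then show ?case by (cases b) (auto simp: all_prefix_Cons)
qed (auto simp: all_prefix_Cons)

lemma dyck_words_3d_iff: "w \<in> dyck_words_3d k \<longleftrightarrow> walk 0 0 w \<and> count_list w LZ = k"
  by (auto simp: dyck_words_3d_def walk_iff)

fun marked_walk :: "bool \<Rightarrow> nat \<Rightarrow> nat \<Rightarrow> (letter \<times> bool) list \<Rightarrow> bool" where
  "marked_walk q a b [] \<longleftrightarrow> a = 0 \<and> b = 0"
| "marked_walk q a b ((LX, t) # w) \<longleftrightarrow> \<not> t \<and> marked_walk True (Suc a) b w"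
| "marked_walk q a b ((LY, t) # w) \<longleftrightarrow> (t \<longrightarrow> \<not> q) \<and> a > 0 \<and> marked_walk False (a - 1) (Suc b) w"
| "marked_walk q a b ((LZ, t) # w) \<longleftrightarrow> \<not> t \<and> b > 0 \<and> marked_walk False a (b - 1) w"

lemma marked_walk_iff:
  "marked_walk q a b w \<longleftrightarrow> walk a b (map fst w) \<and>
     (\<forall>m < length w. snd (w ! m) \<longrightarrow>
        fst (w ! m) = LY \<and> \<not> (if m = 0 then q else fst (w ! (m - 1)) = LX))"
proof (induction q a b w rule: marked_walk.induct)
qed (auto simp: All_less_Suc2 nth_Cons' split: if_splits)

lemma marked_walk_iff_Ys_not_after_X:
  "marked_walk False 0 0 w \<longleftrightarrow> walk 0 0 (map fst w) \<and>
     {m. m < length w \<and> snd (w ! m)} \<subseteq> Ys_not_after_X (map fst w)"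
  by (auto simp: marked_walk_iff Ys_not_after_X_def)

text \<open>Storing each mark with its letter, instead of in a set of positions, allows recursion
  along the word.\<close>

lemma bij_betw_marked_walk:
  "bij_betw (\<lambda>w. (map fst w, {m. m < length w \<and> snd (w ! m)}))
     {w. marked_walk False 0 0 w \<and> count_list (map fst w) LZ = k \<and>
         card {m. m < length w \<and> snd (w ! m)} = i}
     {(w, M). w \<in> dyck_words_3d k \<and> M \<subseteq> Ys_not_after_X w \<and> card M = i}"
proof -
  define g where "g = (\<lambda>(w :: letter list, M). map (\<lambda>m. (w ! m, m \<in> M)) [0..<length w])"
  have g: "map fst (g (w, M)) = w" "length (g (w, M)) = length w" for w M
    by (auto simp: g_def intro: nth_equalityI)
  have marked: "{m. m < length w \<and> snd (g (w, M) ! m)} = M" if "M \<subseteq> Ys_not_after_X w" for w M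
  proof -
    have "{m. m < length w \<and> snd (g (w, M) ! m)} = {m. m < length w \<and> m \<in> M}"
      by (simp add: g_def cong: conj_cong)
    then show ?thesis using that by (auto simp: Ys_not_after_X_def)
  qed
  show ?thesis
  proof (rule bij_betw_byWitness[where f' = g], goal_cases)
    case 1
    show ?case by (auto simp: g_def intro: nth_equalityI)
  next
    case 2
    show ?case by (auto simp: g marked)
  next
    case 3
    show ?case by (auto simp: dyck_words_3d_iff marked_walk_iff_Ys_not_after_X)
  next
    case 4
    show ?case by (rule image_subsetI) (clarsimp simp: dyck_words_3d_iff marked_walk_iff_Ys_not_after_X g marked)
  qed
qed

text \<open>An entry \<open>(x, v)\<close> at a position consists of the prefix maximum \<open>x\<close> and of the information
  \<open>v\<close> whether the position is the NE endpoint of a hook. In \<open>code m i b\<close>, \<open>i\<close> positions have been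
  read, \<open>m\<close> is the current maximum and \<open>b\<close> hooks are open.\<close>

fun code :: "nat \<Rightarrow> nat \<Rightarrow> nat \<Rightarrow> (nat \<times> bool) list \<Rightarrow> bool" where
  "code m i b [] \<longleftrightarrow> m = i \<and> b = 0"
| "code m i b ((x, v) # c) \<longleftrightarrow>
     (if x = m then \<not> v \<and> i < m \<and> code m (Suc i) (Suc b) c
      else m < x \<and> (if v then b > 0 \<and> code x (Suc i) (b - 1) c
        else c \<noteq> [] \<and> fst (hd c) = x \<and> code x (Suc i) b c))"

section \<open>Translation between marked walks and codes\<close>

fun decode :: "nat \<Rightarrow> (letter \<times> bool) list \<Rightarrow> (nat \<times> bool) list" where
  "decode m [] = []"
| "decode m ((LX, t) # w) = decode (Suc m) w"
| "decode m ((LY, t) # w) =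
     (if t then (m, False) # decode m w else (Suc m, False) # (Suc m, False) # decode (Suc m) w)"
| "decode m ((LZ, t) # w) = (Suc m, True) # decode (Suc m) w"

text \<open>A rise that is not an NE endpoint and the repeated maximum after it come from one
  unmarked \<open>LY\<close>, so \<open>tl\<close> drops the second entry. The letter closing a
  block raises the maximum by one itself, which leaves \<open>x - Suc m\<close> letters
  \<open>LX\<close>.\<close>

function encode :: "nat \<Rightarrow> (nat \<times> bool) list \<Rightarrow> (letter \<times> bool) list" where
  "encode m [] = []"
| "encode m ((x, v) # c) =
     (if x = m then (LY, True) # encode m c
      else replicate (x - Suc m) (LX, False) @
        (if v then (LZ, False) # encode x c else (LY, False) # encode x (tl c)))"
  by pat_completeness auto
termination by (relation "Wellfounded.measure (length \<circ> snd)") auto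

text \<open>Here \<open>m\<close> is the last maximum written and \<open>e\<close> the number of
  \<open>LX\<close> read since then. The excess of \<open>LX\<close> over \<open>LY\<close> is the
  height minus the number of positions, \<open>m + e - i\<close>: an unmarked \<open>LY\<close> adds
  1 to the height and 2 positions, a marked one only a position, and \<open>LZ\<close> one of
  each.\<close>

lemma code_decode:
  "marked_walk (e > 0) (m + e - i) b w \<Longrightarrow> i \<le> m \<Longrightarrow> code m i b (decode (m + e) w)"
proof (induction w arbitrary: m e i b)
  case (Cons l w)
  obtain y t where l: "l = (y, t)" by force
  show ?case
  proof (cases y)
    case LX
    then show ?thesis using Cons.prems Cons.IH[of "Suc e" m i b] by (simp add: l Suc_diff_le)
  next
    case LY
    then show ?thesis using Cons.prems Cons.IH[of 0 "Suc (m + e)" "Suc (Suc i)" "Suc b"] Cons.IH[of 0 m "Suc i" "Suc b"]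
      by (auto simp: l)
  next
    case LZ
    then show ?thesis using Cons.prems Cons.IH[of 0 "Suc (m + e)" "Suc i" "b - 1"]
      by (auto simp: l)
  qed
qed auto

text \<open>\<open>decode\<close> has absorbed \<open>e\<close> pending letters \<open>LX\<close>
  into its accumulator; \<open>encode\<close>, starting from the last maximum written, returns them
  in front of \<open>w\<close>.\<close>

lemma encode_decode:
  "marked_walk (e > 0) a b w \<Longrightarrow> a \<ge> e \<Longrightarrow> encode m (decode (m + e) w) = replicate e (LX, False) @ w"
proof (induction w arbitrary: m e a b)
  case (Cons l w)
  obtain y t where l: "l = (y, t)" by force
  show ?case
  proof (cases y)
    case LX
    then show ?thesis using Cons.prems Cons.IH[of "Suc e" "Suc a" b m]
      by (simp add: l replicate_append_same[symmetric])
  next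
    case LY
    then show ?thesis using Cons.prems Cons.IH[of 0 "a - 1" "Suc b" m] Cons.IH[of 0 "a - 1" "Suc b" "Suc (m + e)"]
      by (auto simp: l)
  next
    case LZ
    then show ?thesis using Cons.prems Cons.IH[of 0 a "b - 1" "Suc (m + e)"] by (auto simp: l)
  qed
qed simp

lemma decode_replicate_LX: "decode m (replicate e (LX, False) @ w) = decode (m + e) w"
  by (induction e arbitrary: m) auto

lemma marked_walk_replicate_LX:
  "marked_walk q a b (replicate e (LX, False) @ w) = marked_walk (q \<or> e > 0) (a + e) b w"
  by (induction e arbitrary: q a) auto

lemma decode_encode: "code m i b c \<Longrightarrow> decode m (encode m c) = c"
proof (induction m c arbitrary: i b rule: encode.induct)
  case (2 m x v c)
  then show ?case by (cases c) (force simp: decode_replicate_LX split: if_splits)+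
qed simp

lemma marked_walk_encode: "code m i b c \<Longrightarrow> i \<le> m \<Longrightarrow> marked_walk False (m - i) b (encode m c)"
proof (induction m c arbitrary: i b rule: encode.induct)
  case (2 m x v c)
  then show ?case
    by (cases c) (force simp: marked_walk_replicate_LX Suc_diff_Suc split: if_splits)+
qed simp

text \<open>An unmarked \<open>LY\<close> writes two entries, a marked one a single entry,
  \<open>LZ\<close> one and \<open>LX\<close> none.\<close>

lemma length_decode:
  "length (decode m w) + length (filter snd w) =
     2 * count_list (map fst w) LY + count_list (map fst w) LZ"
  if "marked_walk q a b w"
  using that by (induction q a b w arbitrary: m rule: marked_walk.induct) auto

lemma length_filter_snd_decode: "length (filter snd (decode m w)) = count_list (map fst w) LZ"
  by (induction m w rule: decode.induct) auto

lemma bij_betw_decode: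
  assumes "i \<le> k"
  shows "bij_betw (decode 0)
     {w. marked_walk False 0 0 w \<and> count_list (map fst w) LZ = k \<and>
         card {m. m < length w \<and> snd (w ! m)} = i}
     {c. code 0 0 0 c \<and> length c = 3 * k - i \<and> length (filter snd c) = k}"
proof -
  have len: "length (decode 0 w) + card {m. m < length w \<and> snd (w ! m)} = 3 * count_list (map fst w) LZ"
    and *: "encode 0 (decode 0 w) = w"  "code 0 0 0 (decode 0 w)"
    if "marked_walk False 0 0 w" for w
  proof -
    have "walk 0 0 (map fst w)" using that by (simp add: marked_walk_iff)
    then show "length (decode 0 w) + card {m. m < length w \<and> snd (w ! m)} = 3 * count_list (map fst w) LZ"
      using length_decode[OF that, of 0] by (simp add: walk_iff length_filter_conv_card)
    show "encode 0 (decode 0 w) = w"  "code 0 0 0 (decode 0 w)"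
      using that encode_decode[of 0 0 0 w 0] code_decode[of 0 0 0 0 w] by auto
  qed
  show ?thesis
  proof (rule bij_betw_byWitness[where f' = "encode 0"], goal_cases)
    case 1
    then show ?case using * by auto
  next
    case 2
    then show ?case using decode_encode by auto
  next
    case 3
    then show ?case using * len by (force simp: length_filter_snd_decode)
  next
    case 4
    show ?case
    proof (rule image_subsetI, clarify)
      fix c assume c: "code 0 0 0 c" "length c = 3 * length (filter snd c) - i"
        "k = length (filter snd c)"
      have w: "marked_walk False 0 0 (encode 0 c)" and d: "decode 0 (encode 0 c) = c"
        using c(1) decode_encode marked_walk_encode[of 0 0 0 c] by auto
      \<comment> \<open>Since \<open>i \<le> k\<close>, the difference \<open>3 * k - i\<close> is
        not truncated, so the length determines the number of marks.\<close>
      show "marked_walk False 0 0 (encode 0 c) \<and>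
          count_list (map fst (encode 0 c)) LZ = length (filter snd c) \<and>
          card {m. m < length (encode 0 c) \<and> snd (encode 0 c ! m)} = i"
        using w len[OF w] length_filter_snd_decode[of 0 "encode 0 c"] c assms by (simp add: d)
    qed
  qed
qed

subsection \<open>Permutations avoiding 312\<close>

text \<open>Inserting 0 gives the empty prefix the maximum 0, below every entry.\<close>

definition prefix_max :: "nat list \<Rightarrow> nat \<Rightarrow> nat" where
  "prefix_max p i = Max (insert 0 (set (take i p)))"

lemma prefix_max_0 [simp]: "prefix_max p 0 = 0"
  by (simp add: prefix_max_def)

lemma prefix_max_Suc: "i < length p \<Longrightarrow> prefix_max p (Suc i) = max (prefix_max p i) (p ! i)"
  by (simp add: prefix_max_def take_Suc_conv_app_nth insert_commute max.commute flip: Max_insert)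

lemma nth_le_prefix_max: "l < i \<Longrightarrow> l < length p \<Longrightarrow> p ! l \<le> prefix_max p i"
  unfolding prefix_max_def by (rule Max_ge) (auto simp: in_set_conv_nth intro!: exI[of _ l])

lemma prefix_max_attained:
  assumes "prefix_max p i \<noteq> 0"
  shows "\<exists>l<i. l < length p \<and> p ! l = prefix_max p i"
proof -
  have "prefix_max p i \<in> insert 0 (set (take i p))"
    unfolding prefix_max_def by (rule Max_in) auto
  then show ?thesis using assms by (auto simp: in_set_conv_nth)
qed

lemma Av_312_D:
  assumes "p \<in> Av_312 n"
  shows "length p = n" "distinct p" "set p = {1..n}" "avoids_312 p"
proof -
  show *: "distinct p" "set p = {1..n}" "avoids_312 p"
    using assms by (simp_all add: Av_312_def permutations_of_set_def)
  show "length p = n" using distinct_card[OF *(1)] *(2) by simp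
qed

lemma avoids_312_nth:
  "avoids_312 p \<longleftrightarrow> (\<forall>a b c. a < b \<longrightarrow> b < c \<longrightarrow> c < length p \<longrightarrow> p ! b < p ! c \<longrightarrow> \<not> p ! c < p ! a)"
  (is "_ \<longleftrightarrow> ?R")
proof
  assume *: "avoids_312 p"
  show ?R
  proof (intro allI impI notI)
    fix a b c assume "a < b" "b < c" "c < length p" "p ! b < p ! c" "p ! c < p ! a"
    then have "1 \<le> Suc a \<and> Suc a < Suc b \<and> Suc b < Suc c \<and> Suc c \<le> length p \<and>
      entry p (Suc b) < entry p (Suc c) \<and> entry p (Suc c) < entry p (Suc a)"
      by (simp add: entry_def)
    with * show False unfolding avoids_312_def by blast
  qed
next
  assume R: ?R
  show "avoids_312 p"
    unfolding avoids_312_def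
  proof (clarify)
    fix a b c assume "1 \<le> a" "a < b" "b < c" "c \<le> length p"
      "entry p b < entry p c" "entry p c < entry p a"
    with R[rule_format, of "a - 1" "b - 1" "c - 1"] show False
      by (simp add: entry_def)
  qed
qed

lemma Av_312_nth:
  assumes "p \<in> Av_312 n" "i < n"
  shows "p ! i = Max ({1..prefix_max p (Suc i)} - set (take i p))"
proof (rule sym, rule Max_eqI)
  note p = Av_312_D[OF assms(1)]
  show "p ! i \<in> {1..prefix_max p (Suc i)} - set (take i p)"
    using p assms(2) nth_le_prefix_max[of i "Suc i" p] nth_mem[of i p]
    by (auto simp: in_set_conv_nth nth_eq_iff_index_eq)
next
  note p = Av_312_D[OF assms(1)]
  fix v assume v: "v \<in> {1..prefix_max p (Suc i)} - set (take i p)"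
  show "v \<le> p ! i"
  proof (rule ccontr)
    assume less: "\<not> v \<le> p ! i"
    obtain a where a: "a < Suc i" "a < length p" "p ! a = prefix_max p (Suc i)"
      using v prefix_max_attained[of p "Suc i"] by auto
    have "a \<noteq> i" using a v less by auto
    then have ai: "a < i" using a by simp
    have "prefix_max p (Suc i) \<in> set p" using nth_mem[OF a(2)] a(3) by simp
    then have "v \<in> set p" using v p by auto
    then obtain c where c: "c < length p" "p ! c = v" by (auto simp: in_set_conv_nth)
    have "\<not> c < i" using v c by (auto simp: in_set_conv_nth)
    moreover have "c \<noteq> i" using c less by auto
    ultimately have "i < c" by simp
    moreover have "v \<noteq> p ! a" using v ai a by (auto simp: in_set_conv_nth)
    ultimately show False using p(4) ai c less v a
      unfolding avoids_312_nth by (metis DiffD1 atLeastAtMost_iff nat_less_le not_le)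
  qed
qed simp

lemma prefix_max_inj:
  assumes "p \<in> Av_312 n" "q \<in> Av_312 n" "\<And>i. i \<le> n \<Longrightarrow> prefix_max p i = prefix_max q i"
  shows "p = q"
proof -
  note p = Av_312_D[OF assms(1)] and q = Av_312_D[OF assms(2)]
  have "take i p = take i q" if "i \<le> n" for i
    using that
  proof (induction i)
    case (Suc i)
    then show ?case using p q assms(3)[of "Suc i"] Av_312_nth[OF assms(1), of i] Av_312_nth[OF assms(2), of i]
      by (simp add: take_Suc_conv_app_nth)
  qed simp
  from this[of n] show ?thesis using p q by simp
qed

lemma le_prefix_max:
  assumes "p \<in> Av_312 n" "i \<le> n"
  shows "i \<le> prefix_max p i"
proof -
  note p = Av_312_D[OF assms(1)]
  have "i = card (set (take i p))"
    using p assms(2) by (metis distinct_card distinct_take length_take min.absorb2)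
  also have "\<dots> \<le> card {1..prefix_max p i}"
  proof (rule card_mono)
    have "set (take i p) \<subseteq> {1..n}" using p set_take_subset[of i p] by simp
    moreover have "x \<le> prefix_max p i" if "x \<in> set (take i p)" for x
      using that by (simp add: prefix_max_def)
    ultimately show "set (take i p) \<subseteq> {1..prefix_max p i}" by fastforce
  qed simp
  finally show ?thesis by simp
qed

lemma prefix_max_length:
  assumes "p \<in> Av_312 n"
  shows "prefix_max p n = n"
proof -
  note p = Av_312_D[OF assms]
  have "prefix_max p n \<le> n" using p by (auto simp: prefix_max_def)
  then show ?thesis using le_prefix_max[OF assms, of n] by simp
qed

lemma entry_eq_iff:
  assumes "p \<in> Av_312 n" "i \<in> {1..n}" "j \<in> {1..n}"
  shows "entry p i = entry p j \<longleftrightarrow> i = j"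
  using Av_312_D[OF assms(1)] assms(2,3) by (auto simp: entry_def nth_eq_iff_index_eq)

text \<open>If an entry at \<open>l < j - 1\<close> exceeded the one at \<open>j\<close>, then
  \<open>l\<close>, \<open>j - 1\<close>, \<open>j\<close> would form 312, because
  \<open>j - 1\<close> is an ascent. This makes the ends of hooks left-to-right maxima.\<close>

lemma entry_less_if_not_descent_bottom:
  assumes "p \<in> Av_312 n" "j \<in> {1..n}" "j \<notin> Suc ` descents p" "1 \<le> l" "l < j"
  shows "entry p l < entry p j"
proof -
  note p = Av_312_D[OF assms(1)]
  have "j - 1 \<notin> descents p" using assms by (metis One_nat_def Suc_pred' image_eqI less_nat_zero_code not_gr0)
  moreover have "j - 1 \<in> {1..n}" "j - 1 \<noteq> j" using assms by auto
  then have "entry p (j - 1) \<noteq> entry p j"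
    using entry_eq_iff[OF assms(1) _ assms(2)] by blast
  ultimately have *: "entry p (j - 1) < entry p j" using assms p by (auto simp: descents_def)
  show ?thesis
  proof (cases "l = j - 1")
    case False
    then have "l < j - 1" "j - 1 < j" "j \<le> length p" using assms p by auto
    then have "\<not> entry p j < entry p l" using p(4) * assms(4) unfolding avoids_312_def by blast
    moreover have "entry p l \<noteq> entry p j"
      using entry_eq_iff[OF assms(1), of l j] assms by auto
    ultimately show ?thesis by simp
  qed (use * in simp)
qed

text \<open>A descent keeps the maximum, whereas an ascent ends in a left-to-right maximum and
  raises it.\<close>

lemma descents_iff:
  assumes "p \<in> Av_312 n"
  shows "i \<in> descents p \<longleftrightarrow> i < n \<and> prefix_max p i = prefix_max p (Suc i)"
proof (cases "1 \<le> i \<and> i < n")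
  case True
  note p = Av_312_D[OF assms]
  have M: "prefix_max p (Suc i) = max (prefix_max p i) (entry p (Suc i))"
    using True p by (simp add: prefix_max_Suc entry_def)
  show ?thesis
  proof
    assume "i \<in> descents p"
    then have "entry p (Suc i) < entry p i" by (simp add: descents_def)
    also have "\<dots> \<le> prefix_max p i" using True p by (auto simp: entry_def intro!: nth_le_prefix_max)
    finally show "i < n \<and> prefix_max p i = prefix_max p (Suc i)" using M True by simp
  next
    assume "i < n \<and> prefix_max p i = prefix_max p (Suc i)"
    then have le: "entry p (Suc i) \<le> prefix_max p i" using M by linarith
    obtain l where l: "l < i" "entry p (Suc l) = prefix_max p i"
      using prefix_max_attained[of p i] le_prefix_max[OF assms, of i] True by (auto simp: entry_def)
    show "i \<in> descents p"
      using entry_less_if_not_descent_bottom[OF assms, of "Suc i" "Suc l"] l le True by force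
  qed
next
  case False
  then have "i \<notin> descents p" using Av_312_D(1)[OF assms] by (auto simp: descents_def)
  \<comment> \<open>Only \<open>i = 0\<close> is in question; there the maximum jumps from 0 to at
    least 1.\<close>
  moreover have "\<not> (i < n \<and> prefix_max p i = prefix_max p (Suc i))"
  proof
    assume *: "i < n \<and> prefix_max p i = prefix_max p (Suc i)"
    with False have "i = 0" by auto
    with * le_prefix_max[OF assms, of 1] show False by simp
  qed
  ultimately show ?thesis by blast
qed

section \<open>Realizing a given sequence of prefix maxima by a permutation\<close>

primrec greedy :: "(nat \<Rightarrow> nat) \<Rightarrow> nat \<Rightarrow> nat list" where
  "greedy m 0 = []"
| "greedy m (Suc i) = greedy m i @ [Max ({1..m (Suc i)} - set (greedy m i))]"

lemma length_greedy [simp]: "length (greedy m i) = i"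
  by (induction i) auto

lemma take_greedy: "i \<le> n \<Longrightarrow> take i (greedy m n) = greedy m i"
  by (induction n) (auto simp: le_Suc_eq)

lemma greedy_nth: "i < n \<Longrightarrow> greedy m n ! i = Max ({1..m (Suc i)} - set (greedy m i))"
  using take_greedy[of "Suc i" n m] by (metis greedy.simps(2) length_greedy lessI nth_append_length nth_take Suc_leI)

text \<open>Prefix maxima of a permutation in \<open>Av_312 n\<close> have these properties; the
  greedy rule of \<open>Av_312_nth\<close> shows that they also suffice.\<close>

context
  fixes m :: "nat \<Rightarrow> nat" and n :: nat
  assumes m_0: "m 0 = 0" and m_mono: "\<And>i. i < n \<Longrightarrow> m i \<le> m (Suc i)"
    and le_m: "\<And>i. i \<le> n \<Longrightarrow> i \<le> m i" and m_n: "m n = n"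
begin

lemma greedy_invariant:
  "i \<le> n \<Longrightarrow> distinct (greedy m i) \<and> set (greedy m i) \<subseteq> {1..m i} \<and>
     Max (insert 0 (set (greedy m i))) = m i"
proof (induction i)
  case (Suc i)
  then have IH: "distinct (greedy m i)" "set (greedy m i) \<subseteq> {1..m i}"
    "Max (insert 0 (set (greedy m i))) = m i" and mono: "m i \<le> m (Suc i)" using m_mono by auto
  let ?A = "{1..m (Suc i)} - set (greedy m i)"
  have "card (set (greedy m i)) = i" using IH(1) by (simp add: distinct_card)
  moreover have "i < m (Suc i)" using le_m[OF Suc.prems] by simp
  ultimately have "?A \<noteq> {}"
    using card_mono[of "set (greedy m i)" "{1..m (Suc i)}"] by auto
  then have v: "Max ?A \<in> ?A" by (intro Max_in) auto
  have "max (Max ?A) (m i) = m (Suc i)"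
  proof (cases "m i = m (Suc i)")
    case False
    then have "m (Suc i) \<in> ?A" using mono IH(2) by auto
    then have "m (Suc i) \<le> Max ?A" by (intro Max_ge) auto
    then show ?thesis using v mono by auto
  qed (use v in auto)
  moreover have "Max (insert 0 (set (greedy m (Suc i)))) = max (Max ?A) (Max (insert 0 (set (greedy m i))))"
    by (simp add: insert_commute flip: Max_insert)
  ultimately show ?case using v IH mono by auto
qed (simp add: m_0)

lemma greedy_Av_312: "greedy m n \<in> Av_312 n"
proof -
  let ?p = "greedy m n"
  have d: "distinct ?p" and s: "set ?p \<subseteq> {1..n}" using greedy_invariant[of n] m_n by auto
  have "set ?p = {1..n}" by (rule card_subset_eq) (use d s in \<open>auto simp: distinct_card\<close>)
  moreover have "avoids_312 ?p"
    unfolding avoids_312_nth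
  proof (intro allI impI notI)
    fix a b c assume abc: "a < b" "b < c" "c < length ?p" "?p ! b < ?p ! c" "?p ! c < ?p ! a"
    have "?p ! a \<in> set (take b ?p)" using abc by (auto simp: in_set_conv_nth)
    then have "?p ! a \<le> m b" using greedy_invariant[of b] take_greedy[of b n m] abc by auto
    also have "\<dots> \<le> m (Suc b)" using m_mono abc by simp
    finally have "?p ! c \<le> m (Suc b)" using abc by simp
    moreover have "?p ! c \<in> {1..n}" using s abc by (meson nth_mem subsetD)
    moreover have "?p ! c \<notin> set (greedy m b)"
      using d abc by (auto simp: in_set_conv_nth nth_eq_iff_index_eq simp flip: take_greedy[of b n m])
    ultimately have "?p ! c \<in> {1..m (Suc b)} - set (greedy m b)" by simp
    then have "?p ! c \<le> ?p ! b" using abc by (simp add: greedy_nth Max_ge)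
    then show False using abc by simp
  qed
  ultimately show ?thesis using d by (simp add: Av_312_def permutations_of_set_def)
qed

lemma prefix_max_greedy: "i \<le> n \<Longrightarrow> prefix_max (greedy m n) i = m i"
  using greedy_invariant by (simp add: prefix_max_def take_greedy)

end

subsection \<open>Noncrossing matchings\<close>

text \<open>The strict \<open>i' < j\<close> lets a pair start where another ends, just as the NE
  endpoint of a hook may be the SW endpoint of the next.\<close>

definition noncrossing_matching :: "nat set \<Rightarrow> nat set \<Rightarrow> (nat \<times> nat) set \<Rightarrow> bool" where
  "noncrossing_matching D N R \<longleftrightarrow> inj_on fst R \<and> inj_on snd R \<and> fst ` R = D \<and> snd ` R = N \<and>
     (\<forall>(i, j)\<in>R. i < j) \<and>
     (\<forall>(i, j)\<in>R. \<forall>(i', j')\<in>R. i < i' \<longrightarrow> i' < j \<longrightarrow> j' < j)"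

lemma noncrossing_matching_card:
  assumes "noncrossing_matching D N R"
  shows "card R = card N" "card D = card N"
  using assms card_image[of fst R] card_image[of snd R] by (auto simp: noncrossing_matching_def)

text \<open>The ballot inequality: every right end up to \<open>j\<close> has its partner strictly
  before \<open>j\<close>.\<close>

lemma noncrossing_matching_card_le:
  assumes "noncrossing_matching D N R" "finite D"
  shows "card (N \<inter> {..j}) \<le> card (D \<inter> {..<j})"
proof -
  have R: "inj_on fst R" "inj_on snd R" "fst ` R = D" "snd ` R = N" "\<And>r. r \<in> R \<Longrightarrow> fst r < snd r"
    using assms(1) by (auto simp: noncrossing_matching_def)
  have fin: "finite R" using assms(2) R finite_imageD by blast
  have "card (N \<inter> {..j}) = card (snd ` {r \<in> R. snd r \<le> j})"
    using R by (intro arg_cong[of _ _ card]) auto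
  also have "\<dots> = card {r \<in> R. snd r \<le> j}"
    using R by (intro card_image) (auto simp: inj_on_def)
  also have "\<dots> \<le> card {r \<in> R. fst r < j}"
    using fin R(5) by (intro card_mono) force+
  also have "\<dots> = card (fst ` {r \<in> R. fst r < j})"
    using R by (intro card_image[symmetric]) (auto simp: inj_on_def)
  also have "fst ` {r \<in> R. fst r < j} = D \<inter> {..<j}" using R by auto
  finally show ?thesis .
qed

text \<open>If the partner of the first right end \<open>j\<close> were left of \<open>i\<close>,
  the pair starting at \<open>i\<close> would be nested inside and end before \<open>j\<close>,
  against minimality. So the matching can be peeled off pair by pair.\<close>

lemma noncrossing_matching_min:
  assumes "noncrossing_matching D N R" "finite D" "finite N" "N \<noteq> {}"
  defines "j \<equiv> Min N" defines "i \<equiv> Max {i \<in> D. i < j}"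
  shows "(i, j) \<in> R" "noncrossing_matching (D - {i}) (N - {j}) (R - {(i, j)})"
proof -
  have R: "inj_on fst R" "inj_on snd R" "fst ` R = D" "snd ` R = N" "\<And>a b. (a, b) \<in> R \<Longrightarrow> a < b"
    "\<And>a b a' b'. (a, b) \<in> R \<Longrightarrow> (a', b') \<in> R \<Longrightarrow> a < a' \<Longrightarrow> a' < b \<Longrightarrow> b' < b"
    using assms(1) by (auto simp: noncrossing_matching_def)
  have j: "j \<in> N" "\<And>b. b \<in> N \<Longrightarrow> j \<le> b" using assms by (auto simp: j_def)
  obtain a where a: "(a, j) \<in> R" using j R(4) by force
  have aD: "a \<in> {i \<in> D. i < j}" using a R(3,5) by force
  moreover have fin: "finite {i \<in> D. i < j}" using assms(2) by simp
  ultimately have "a \<le> i" and "i \<in> {i \<in> D. i < j}"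
    using Max_ge[OF fin aD] Max_in[OF fin] unfolding i_def by blast+
  then have "i \<in> D" "i < j" by auto
  then obtain b where b: "(i, b) \<in> R" using R(3) by force
  then have "j \<le> b" using j R(4) by force
  then have "\<not> a < i" using R(6)[OF a b] \<open>i < j\<close> by auto
  then have "a = i" using \<open>a \<le> i\<close> by simp
  then show ij: "(i, j) \<in> R" using a by simp
  have "fst ` (R - {(i, j)}) = D - {i}"
    using inj_on_image_set_diff[OF R(1), of R "{(i, j)}"] ij R(3) by simp
  moreover have "snd ` (R - {(i, j)}) = N - {j}"
    using inj_on_image_set_diff[OF R(2), of R "{(i, j)}"] ij R(4) by simp
  moreover have "inj_on fst (R - {(i, j)})" "inj_on snd (R - {(i, j)})"
    using R(1,2) by (auto intro: inj_on_subset)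
  ultimately show "noncrossing_matching (D - {i}) (N - {j}) (R - {(i, j)})"
    using R(5,6) unfolding noncrossing_matching_def by fast
qed

lemma noncrossing_matching_unique:
  assumes "noncrossing_matching D N R" "noncrossing_matching D N R'" "finite D" "finite N"
  shows "R = R'"
  using assms
proof (induction "card N" arbitrary: D N R R')
  case 0
  then show ?case by (auto simp: noncrossing_matching_def)
next
  case (Suc n)
  then have "N \<noteq> {}" by auto
  define j where "j = Min N"
  define i where "i = Max {i \<in> D. i < j}"
  have "(i, j) \<in> R" "(i, j) \<in> R'" and
    "noncrossing_matching (D - {i}) (N - {j}) (R - {(i, j)})"
    "noncrossing_matching (D - {i}) (N - {j}) (R' - {(i, j)})"
    unfolding i_def j_def using noncrossing_matching_min Suc.prems \<open>N \<noteq> {}\<close> by blast+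
  moreover have "n = card (N - {j})" using Suc \<open>N \<noteq> {}\<close> by (simp add: j_def)
  ultimately have "R - {(i, j)} = R' - {(i, j)}" using Suc.hyps(1) Suc.prems by blast
  then show ?case using \<open>(i, j) \<in> R\<close> \<open>(i, j) \<in> R'\<close> by blast
qed

text \<open>The same pair is removed as in \<open>noncrossing_matching_min\<close>. The ballot
  inequality survives: before \<open>j\<close> there are no right ends, and from \<open>j\<close> on
  both counts drop by one.\<close>

lemma noncrossing_matching_exists:
  assumes "finite D" "finite N" "card D = card N" "\<And>j. card (N \<inter> {..j}) \<le> card (D \<inter> {..<j})"
  shows "\<exists>R. noncrossing_matching D N R"
  using assms
proof (induction "card N" arbitrary: D N)
  case 0
  then show ?case by (auto simp: noncrossing_matching_def intro!: exI[of _ "{}"])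
next
  case (Suc n)
  then have "N \<noteq> {}" by auto
  define j where "j = Min N"
  define i where "i = Max {i \<in> D. i < j}"
  have j: "j \<in> N" "\<And>b. b \<in> N \<Longrightarrow> j \<le> b" using Suc.prems \<open>N \<noteq> {}\<close> by (auto simp: j_def)
  have "N \<inter> {..j} \<noteq> {}" using j by auto
  then have "card (N \<inter> {..j}) > 0" using Suc.prems by (simp add: card_gt_0_iff)
  then have "card (D \<inter> {..<j}) > 0" using Suc.prems(4)[of j] by linarith
  then have "D \<inter> {..<j} \<noteq> {}" by (metis card.empty less_irrefl)
  then have "{i \<in> D. i < j} \<noteq> {}" by auto
  then have "i \<in> {i \<in> D. i < j}" unfolding i_def using Suc.prems by (intro Max_in) auto
  then have i: "i \<in> D" "i < j" by auto
  have i_max: "a \<le> i" if "a \<in> D" "a < j" for a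
    unfolding i_def using Suc.prems that by (intro Max_ge) auto
  have le: "card ((N - {j}) \<inter> {..t}) \<le> card ((D - {i}) \<inter> {..<t})" for t
  proof (cases "t < j")
    case True
    then have "(N - {j}) \<inter> {..t} = {}" using j(2) by force
    then show ?thesis by simp
  next
    case False
    then have "(N - {j}) \<inter> {..t} = (N \<inter> {..t}) - {j}" "(D - {i}) \<inter> {..<t} = (D \<inter> {..<t}) - {i}"
      "j \<in> N \<inter> {..t}" "i \<in> D \<inter> {..<t}" using i j by auto
    then show ?thesis using Suc.prems(4)[of t] by (simp add: card_Diff_singleton diff_le_mono)
  qed
  have "n = card (N - {j})" "card (D - {i}) = card (N - {j})"
    using Suc.hyps(2) Suc.prems i j by simp_all
  then obtain R where R: "noncrossing_matching (D - {i}) (N - {j}) R"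
    using Suc.hyps(1) le finite_Diff[OF Suc.prems(1)] finite_Diff[OF Suc.prems(2)] by blast
  have fR: "a \<in> D \<and> a \<noteq> i \<and> b \<in> N \<and> b \<noteq> j \<and> a < b" if "(a, b) \<in> R" for a b
  proof -
    have "fst ` R = D - {i}" "snd ` R = N - {j}" "\<forall>(i, j)\<in>R. i < j"
      using R by (simp_all add: noncrossing_matching_def)
    moreover have "a \<in> fst ` R" "b \<in> snd ` R" using that by force+
    ultimately show ?thesis using that by blast
  qed
  have "noncrossing_matching D N (insert (i, j) R)"
    unfolding noncrossing_matching_def
  proof (intro conjI)
    show "inj_on fst (insert (i, j) R)" "inj_on snd (insert (i, j) R)"
      using R by (auto simp: noncrossing_matching_def)
    show "fst ` insert (i, j) R = D" "snd ` insert (i, j) R = N"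
      using R i j by (auto simp: noncrossing_matching_def)
    show "\<forall>(a, b)\<in>insert (i, j) R. a < b" using i fR by auto
    show "\<forall>(a, b)\<in>insert (i, j) R. \<forall>(a', b')\<in>insert (i, j) R. a < a' \<longrightarrow> a' < b \<longrightarrow> b' < b"
    proof (clarify)
      fix a b a' b' assume *: "(a, b) \<in> insert (i, j) R" "(a', b') \<in> insert (i, j) R" "a < a'" "a' < b"
      \<comment> \<open>No left end lies strictly between \<open>i\<close> and \<open>j\<close> by
        the choice of \<open>i\<close>, and every other right end exceeds \<open>j\<close>.\<close>
      consider "(a, b) \<in> R" "(a', b') \<in> R" | "(a, b) = (i, j)" "(a', b') \<in> R" | "(a', b') = (i, j)" "(a, b) \<in> R"
        using * by auto
      then show "b' < b"
      proof cases
        case 1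
        then show ?thesis using R * unfolding noncrossing_matching_def by blast
      next
        case 2
        then show ?thesis using fR[of a' b'] i_max[of a'] * by auto
      next
        case 3
        then show ?thesis using fR[of a b] j(2)[of b] by auto
      qed
    qed
  qed
  then show ?case by blast
qed

subsection \<open>Valid hook configurations as matchings\<close>

definition lift_hook :: "nat list \<Rightarrow> nat \<times> nat \<Rightarrow> hook" where
  "lift_hook p r = ((fst r, entry p (fst r)), (snd r, entry p (snd r)))"

lemma inj_lift_hook: "inj (lift_hook p)"
  by (auto simp: inj_def lift_hook_def)

lemma hooks_lift:
  assumes "H \<subseteq> hooks p"
  obtains R where "H = lift_hook p ` R" "R \<subseteq> {1..length p} \<times> {1..length p}"
proof
  define R where "R = (\<lambda>(s, t). (fst s, fst t)) ` H"
  have *: "lift_hook p (fst s, fst t) = (s, t) \<and> fst s \<in> {1..length p} \<and> fst t \<in> {1..length p}"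
    if "(s, t) \<in> H" for s t
    using that assms by (auto simp: lift_hook_def hooks_def plot_def)
  show "H = lift_hook p ` R"
    unfolding R_def image_image using * by (force simp: image_iff)
  show "R \<subseteq> {1..length p} \<times> {1..length p}" using * by (force simp: R_def)
qed

lemma mem_hook_curve:
  assumes "i \<le> j" "a \<le> b"
  shows "(x, y) \<in> hook_curve ((i, a), (j, b)) \<longleftrightarrow>
    x = real i \<and> real a \<le> y \<and> y \<le> real b \<or> y = real b \<and> real i \<le> x \<and> x \<le> real j"
  using assms
  by (auto simp: hook_curve_def to_plane_def closed_segment_same_fst closed_segment_same_snd
      closed_segment_eq_real_ivl)

lemma mem_hook_curve_lift:
  assumes "i < j" "entry p i < entry p j"
  shows "(x, y) \<in> hook_curve (lift_hook p (i, j)) \<longleftrightarrow>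
    x = real i \<and> real (entry p i) \<le> y \<and> y \<le> real (entry p j) \<or>
    y = real (entry p j) \<and> real i \<le> x \<and> x \<le> real j"
  using assms by (simp add: lift_hook_def mem_hook_curve)

lemma reduced_lift_iff:
  assumes "R \<subseteq> {1..length p} \<times> {1..length p}"
  shows "reduced p (lift_hook p ` R) \<longleftrightarrow> {1..length p} \<subseteq> fst ` R \<union> snd ` R \<union> Suc ` descents p"
proof -
  let ?g = "\<lambda>i. (i, entry p i)"
  have "plot p = ?g ` {1..length p}" by (auto simp: plot_def)
  moreover have "(\<Union>h\<in>lift_hook p ` R. hook_endpoints h) = ?g ` (fst ` R \<union> snd ` R)"
    by (force simp: hook_endpoints_def lift_hook_def)
  moreover have "descent_bottoms p = ?g ` Suc ` descents p"
    by (auto simp: descent_bottoms_def)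
  moreover have "inj ?g" by (simp add: inj_def)
  ultimately show ?thesis
    unfolding reduced_def by (simp only: image_Un[symmetric] inj_image_subset_iff)
qed

lemma noncrossing_matching_if_valid:
  assumes p: "p \<in> Av_312 n" and R: "R \<subseteq> {1..n} \<times> {1..n}"
    and valid: "valid_hook_configuration p (lift_hook p ` R)"
  shows "noncrossing_matching (descents p) (snd ` R) R" "snd ` R \<inter> Suc ` descents p = {}"
proof -
  have len: "length p = n" using Av_312_D[OF p] by simp
  have less: "i < j" "entry p i < entry p j" if "(i, j) \<in> R" for i j
    using valid that by (auto simp: valid_hook_configuration_def hooks_def lift_hook_def)
  have fst: "fst ` R = descents p"
  proof -
    have "fst ` fst ` lift_hook p ` R = fst ` descent_tops p"
      using valid by (simp add: valid_hook_configuration_def)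
    then show ?thesis by (simp add: image_image lift_hook_def descent_tops_def)
  qed
  have below: "entry p l \<le> entry p j" if ij: "(i, j) \<in> R" "i < l" "l < j" for i j l
  proof -
    have "(l, entry p l) \<in> plot p" using R that len by (force simp: plot_def)
    moreover have "\<forall>r\<in>plot p. \<not> (i < fst r \<and> fst r < j \<and> snd r > entry p j)"
      using valid ij(1) by (fastforce simp: valid_hook_configuration_def lift_hook_def)
    ultimately show ?thesis using that by fastforce
  qed
  \<comment> \<open>Otherwise the vertical part of the second hook meets the horizontal part of the
    first at \<open>?P\<close>: no point lies above a hook, so the height at \<open>j\<close> is
    between those at \<open>i'\<close> and \<open>j'\<close>. Allowing \<open>i = i'\<close> and
    \<open>j = j'\<close> also covers hooks sharing an endpoint, hence both injectivity
    claims.\<close>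
  have crossing: "j' < j" if "(i, j) \<in> R" "(i', j') \<in> R" "(i, j) \<noteq> (i', j')" "i \<le> i'" "i' < j" for i j i' j'
  proof (rule ccontr)
    assume "\<not> j' < j"
    have 1: "entry p i' \<le> entry p j"
      using that below[of i j i'] less[of i j] by (cases "i = i'") auto
    have 2: "entry p j \<le> entry p j'"
      using that below[of i' j' j] \<open>\<not> j' < j\<close> by (cases "j = j'") auto
    let ?P = "(real i', real (entry p j))"
    have "?P \<in> hook_curve (lift_hook p (i, j)) \<inter> hook_curve (lift_hook p (i', j'))"
      using that 1 2 less by (simp add: mem_hook_curve_lift)
    moreover have "hook_curve (lift_hook p (i, j)) \<inter> hook_curve (lift_hook p (i', j')) \<subseteq>
        to_plane ` (hook_endpoints (lift_hook p (i, j)) \<inter> hook_endpoints (lift_hook p (i', j')))"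
      using valid that inj_eq[OF inj_lift_hook[of p], of "(i, j)" "(i', j')"]
      unfolding valid_hook_configuration_def by blast
    \<comment> \<open>The abscissa \<open>i'\<close> rules out the NE endpoint, so \<open>?P\<close>
      would be the SW endpoint of the second hook, forcing \<open>i' = j\<close>.\<close>
    ultimately have "?P \<in> to_plane ` hook_endpoints (lift_hook p (i', j'))" by blast
    then have "entry p j = entry p i'"
      using less(1)[OF that(2)] by (auto simp: to_plane_def hook_endpoints_def lift_hook_def)
    then show False using entry_eq_iff[OF p, of j i'] R that by auto
  qed
  have inj_fst: "inj_on fst R"
  proof (rule inj_onI)
    fix r r' assume *: "r \<in> R" "r' \<in> R" "fst r = fst r'"
    obtain i j j' where r: "r = (i, j)" "r' = (i, j')" using *(3) by (metis prod.collapse)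
    show "r = r'" using crossing[of i j i j'] crossing[of i j' i j] less * by (fastforce simp: r)
  qed
  have "j \<noteq> j'" if "(i, j) \<in> R" "(i', j') \<in> R" "i < i'" for i j i' j'
    using crossing[OF that(1,2)] less(1)[OF that(2)] that(3) by auto
  then have inj_snd: "inj_on snd R"
    unfolding inj_on_def by (metis linorder_neqE_nat prod.collapse)
  show "noncrossing_matching (descents p) (snd ` R) R"
    unfolding noncrossing_matching_def using inj_fst inj_snd fst less crossing by auto
  \<comment> \<open>If a hook ended at the descent bottom \<open>Suc d\<close>, then the descent top
    \<open>d\<close> would be its start, which is too high, or would lie above it.\<close>
  show "snd ` R \<inter> Suc ` descents p = {}"
  proof (rule ccontr)
    assume "snd ` R \<inter> Suc ` descents p \<noteq> {}"
    then obtain i d where *: "(i, Suc d) \<in> R" "d \<in> descents p" by force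
    then have "entry p (Suc d) < entry p d" by (simp add: descents_def)
    then show False using less[OF *(1)] below[OF *(1), of d] by (cases "i = d") auto
  qed
qed

text \<open>A right end that is not a descent bottom exceeds all earlier entries, so every hook
  rises and nothing lies above it. Only disjointness uses noncrossing.\<close>

lemma valid_if_noncrossing_matching:
  assumes p: "p \<in> Av_312 n" and R: "R \<subseteq> {1..n} \<times> {1..n}"
    and nc: "noncrossing_matching (descents p) (snd ` R) R" and "snd ` R \<inter> Suc ` descents p = {}"
  shows "valid_hook_configuration p (lift_hook p ` R)"
proof -
  have len: "length p = n" using Av_312_D[OF p] by simp
  have above: "entry p l < entry p j" if "(i, j) \<in> R" "1 \<le> l" "l < j" for i j l
    using that assms by (intro entry_less_if_not_descent_bottom[OF p]) force+
  have less: "i < j" if "(i, j) \<in> R" for i j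
    using nc that by (auto simp: noncrossing_matching_def)
  have entry_less: "entry p i < entry p j" if "(i, j) \<in> R" for i j
    using above[OF that, of i] less[OF that] R that by auto
  have inter: "hook_curve (lift_hook p (i, j)) \<inter> hook_curve (lift_hook p (i', j')) \<subseteq>
      to_plane ` (hook_endpoints (lift_hook p (i, j)) \<inter> hook_endpoints (lift_hook p (i', j')))"
    if r: "(i, j) \<in> R" "(i', j') \<in> R" "i < i'" for i j i' j'
  proof
    fix P assume P: "P \<in> hook_curve (lift_hook p (i, j)) \<inter> hook_curve (lift_hook p (i', j'))"
    obtain x y where xy: "P = (x, y)" by force
    have inside: "j' < j \<and> entry p j' < entry p j" if "i' < j"
    proof -
      have "j' < j" using nc r that unfolding noncrossing_matching_def by blast
      moreover have "1 \<le> j'" using R r by auto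
      ultimately show ?thesis using above[OF r(1)] by simp
    qed
    \<comment> \<open>A common point has abscissa at least \<open>i' > i\<close>, so it is on the
      horizontal part of the first hook. A hook starting strictly inside the first stays strictly
      below that part, which leaves only \<open>i' = j\<close>.\<close>
    have "y = real (entry p j) \<and> x \<le> real j"
      and c': "x = real i' \<and> y \<le> real (entry p j') \<or> y = real (entry p j') \<and> real i' \<le> x"
      using P r less[OF r(1)] less[OF r(2)] entry_less[OF r(1)] entry_less[OF r(2)]
      by (auto simp: xy mem_hook_curve_lift)
    then have "\<not> i' < j" using inside by auto
    moreover have "i' \<le> j" using c' \<open>y = _ \<and> _\<close> by auto
    ultimately have "i' = j" by simp
    have "x = real j" using c' \<open>y = _ \<and> _\<close> \<open>i' = j\<close> by auto
    then have "P = to_plane (j, entry p j)" using \<open>y = _ \<and> _\<close> by (simp add: xy to_plane_def)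
    then show "P \<in> to_plane ` (hook_endpoints (lift_hook p (i, j)) \<inter> hook_endpoints (lift_hook p (i', j')))"
      using \<open>i' = j\<close> by (simp add: hook_endpoints_def lift_hook_def)
  qed
  have "hook_curve h \<inter> hook_curve h' \<subseteq> to_plane ` (hook_endpoints h \<inter> hook_endpoints h')"
    if h: "h \<in> lift_hook p ` R" "h' \<in> lift_hook p ` R" "h \<noteq> h'" for h h'
  proof -
    obtain i j i' j' where r: "(i, j) \<in> R" "(i', j') \<in> R" "h = lift_hook p (i, j)" "h' = lift_hook p (i', j')"
      using h by auto
    have "inj_on fst R" using nc by (simp add: noncrossing_matching_def)
    then have "i \<noteq> i'" using inj_onD[of fst R "(i, j)" "(i', j')"] r h(3) by auto
    then show ?thesis
      using inter[OF r(1,2)] inter[OF r(2,1)] unfolding r(3,4) by (cases i i' rule: linorder_cases) blast+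
  qed
  moreover have "lift_hook p ` R \<subseteq> hooks p"
    using R less entry_less len by (fastforce simp: hooks_def lift_hook_def plot_def)
  moreover have "fst ` lift_hook p ` R = descent_tops p"
  proof -
    have "fst ` lift_hook p ` R = (\<lambda>i. (i, entry p i)) ` fst ` R"
      by (simp add: image_image lift_hook_def)
    then show ?thesis using nc by (simp add: noncrossing_matching_def descent_tops_def)
  qed
  moreover have "\<not> (\<exists>r\<in>plot p. i < fst r \<and> fst r < j \<and> entry p j < snd r)" if "(i, j) \<in> R" for i j
  proof
    assume "\<exists>r\<in>plot p. i < fst r \<and> fst r < j \<and> entry p j < snd r"
    then obtain l where "1 \<le> l" "l < j" "entry p j < entry p l" by (auto simp: plot_def)
    then show False using above[OF that, of l] by simp
  qed
  then have "\<forall>(s, t)\<in>lift_hook p ` R. \<not> (\<exists>r\<in>plot p. fst s < fst r \<and> fst r < fst t \<and> snd r > snd t)"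
    by (fastforce simp: lift_hook_def)
  ultimately show ?thesis unfolding valid_hook_configuration_def by blast
qed

lemma RedVHC_lift_iff:
  assumes p: "p \<in> Av_312 n" and R: "R \<subseteq> {1..n} \<times> {1..n}"
  shows "(p, lift_hook p ` R) \<in> RedVHC k (Av_312 n) \<longleftrightarrow>
    noncrossing_matching (descents p) (snd ` R) R \<and> snd ` R \<inter> Suc ` descents p = {} \<and>
    {1..n} \<subseteq> descents p \<union> snd ` R \<union> Suc ` descents p \<and> card (snd ` R) = k"
proof -
  have "card (lift_hook p ` R) = card R"
    using inj_lift_hook by (intro card_image) (auto intro: inj_on_subset)
  moreover have "reduced p (lift_hook p ` R) \<longleftrightarrow> {1..n} \<subseteq> fst ` R \<union> snd ` R \<union> Suc ` descents p"
    using reduced_lift_iff[of R p] R Av_312_D(1)[OF p] by simp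
  moreover have "fst ` R = descents p \<and> card R = card (snd ` R)" if "noncrossing_matching (descents p) (snd ` R) R"
    using that noncrossing_matching_card[OF that] by (simp add: noncrossing_matching_def)
  ultimately show ?thesis
    using noncrossing_matching_if_valid[OF p R] valid_if_noncrossing_matching[OF p R] p
    unfolding RedVHC_def by (simp del: atLeastAtMost_iff) metis
qed

subsection \<open>Encoding reduced configurations\<close>

definition ncount :: "(nat \<Rightarrow> bool) \<Rightarrow> nat \<Rightarrow> nat" where
  "ncount P n = card {l. l < n \<and> P l}"

lemma ncount_0 [simp]: "ncount P 0 = 0"
  by (simp add: ncount_def)

lemma ncount_Suc: "ncount P (Suc n) = (if P 0 then 1 else 0) + ncount (\<lambda>l. P (Suc l)) n"
proof -
  have "{l. l < Suc n \<and> P l} = (if P 0 then {0} else {}) \<union> Suc ` {l. l < n \<and> P (Suc l)}"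
    by (auto simp: less_Suc_eq_0_disj)
  then show ?thesis by (simp add: ncount_def card_image)
qed

text \<open>The nonrecursive form of \<open>code\<close>: \<open>M\<close> is the sequence of prefix
  maxima, flat steps are descents and \<open>v\<close> marks NE endpoints. The clauses express, in
  order, feasibility of the maxima, the ballot condition with \<open>b\<close> open hooks, that NE
  endpoints are not descent bottoms, and reducedness.\<close>

definition index_code :: "nat \<Rightarrow> nat \<Rightarrow> nat \<Rightarrow> (nat \<times> bool) list \<Rightarrow> bool" where
  "index_code m i b c \<longleftrightarrow>
     (let M = \<lambda>j. (m # map fst c) ! j; flat = \<lambda>j. M j = M (Suc j);
          v = \<lambda>j. snd (c ! j); n = length c in
      (\<forall>j<n. M j \<le> M (Suc j)) \<and> (\<forall>j<Suc n. i + j \<le> M j) \<and> M n = i + n \<and>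
      (\<forall>j<Suc n. ncount v j \<le> b + ncount flat j) \<and> ncount v n = b + ncount flat n \<and>
      (\<forall>j<n. flat j \<longrightarrow> \<not> v j) \<and>
      (\<forall>j<n. \<not> flat j \<longrightarrow> v j \<or> Suc j < n \<and> flat (Suc j)))"

lemma index_code_Nil: "index_code m i b [] \<longleftrightarrow> m = i \<and> b = 0"
  by (auto simp: index_code_def)

lemma index_code_Cons:
  assumes "i \<le> m"
  shows "index_code m i b ((x, v) # c) \<longleftrightarrow>
     (if x = m then \<not> v \<and> i < m \<and> index_code m (Suc i) (Suc b) c
      else m < x \<and> (if v then b > 0 \<and> index_code x (Suc i) (b - 1) c
        else c \<noteq> [] \<and> fst (hd c) = x \<and> index_code x (Suc i) b c))"
proof -
  \<comment> \<open>Evaluating a shifted inequality at 0 yields \<open>i < m\<close> after a flat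
    step and \<open>b > 0\<close> after an NE endpoint.\<close>
  have *: "(\<forall>j<Suc n. Q j) \<Longrightarrow> Q 0" for Q and n :: nat by blast
  show ?thesis
  proof (cases "x = m")
    case True
    then show ?thesis using assms
      unfolding index_code_def Let_def
      by (simp add: All_less_Suc2 ncount_Suc) (auto dest: *)
  next
    case False
    show ?thesis
    proof (cases v)
      case True
      then show ?thesis using assms False
        unfolding index_code_def Let_def
        by (cases b) (auto simp add: All_less_Suc2 ncount_Suc dest: *)
    next
      case v: False
      show ?thesis
      proof (cases c)
        case Nil
        then show ?thesis using False v by (simp add: index_code_def)
      next
        case (Cons y c')
        then show ?thesis using assms False v
          unfolding index_code_def Let_def
          by (auto simp add: All_less_Suc2 ncount_Suc)
      qed
    qed
  qed
qed

lemma code_iff_index_code: "i \<le> m \<Longrightarrow> code m i b c \<longleftrightarrow> index_code m i b c"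
proof (induction c arbitrary: m i b)
  case (Cons a c)
  obtain x v where a: "a = (x, v)" by force
  show ?case
    unfolding a code.simps index_code_Cons[OF Cons.prems]
    using Cons.IH[of "Suc i" m "Suc b"] Cons.IH[of "Suc i" x "b - 1"] Cons.IH[of "Suc i" x b] Cons.prems
    by auto
qed (simp add: index_code_Nil)

definition vhc_code :: "nat list \<Rightarrow> nat set \<Rightarrow> (nat \<times> bool) list" where
  "vhc_code p N = map (\<lambda>i. (prefix_max p (Suc i), Suc i \<in> N)) [0..<length p]"

lemma card_Suc_vimage: "N \<subseteq> {1..n} \<Longrightarrow> card {l. l < j \<and> Suc l \<in> N} = card (N \<inter> {..j})"
proof -
  assume N: "N \<subseteq> {1..n}"
  have "N \<inter> {..j} = Suc ` {l. l < j \<and> Suc l \<in> N}"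
  proof (intro equalityI subsetI)
    fix i assume i: "i \<in> N \<inter> {..j}"
    then obtain l where "i = Suc l" using N by (cases i) auto
    with i show "i \<in> Suc ` {l. l < j \<and> Suc l \<in> N}" by auto
  qed auto
  then show ?thesis by (simp add: card_image)
qed

text \<open>The feasibility clauses hold for all prefix maxima, so only the conditions on the hooks
  remain. List index \<open>l\<close> stands for position \<open>Suc l\<close> in \<open>N\<close>
  but for the descent \<open>l\<close> in \<open>D\<close>, whence \<open>{..j}\<close> against
  \<open>{..<j}\<close>.\<close>

lemma code_vhc_code_iff:
  assumes p: "p \<in> Av_312 n" and N: "N \<subseteq> {1..n}"
  defines "D \<equiv> descents p"
  shows "code 0 0 0 (vhc_code p N) \<longleftrightarrow>
    card D = card N \<and> (\<forall>j\<le>n. card (N \<inter> {..j}) \<le> card (D \<inter> {..<j})) \<and>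
    N \<inter> Suc ` D = {} \<and> {1..n} \<subseteq> D \<union> N \<union> Suc ` D"
proof -
  let ?c = "vhc_code p N"
  define M where "M = (\<lambda>j. (0 # map fst ?c) ! j)"
  define v where "v = (\<lambda>j. snd (?c ! j))"
  have len: "length p = n" "length ?c = n" using Av_312_D[OF p] by (simp_all add: vhc_code_def)
  have M: "M j = prefix_max p j" if "j \<le> n" for j
    using that len by (cases j) (auto simp: M_def vhc_code_def)
  have v: "v j \<longleftrightarrow> Suc j \<in> N" if "j < n" for j
    using that len by (simp add: v_def vhc_code_def)
  have flat: "M j = M (Suc j) \<longleftrightarrow> j \<in> D" if "j < n" for j
    using that M by (simp add: D_def descents_iff[OF p])
  have D_sub: "D \<subseteq> {..<n}" using descents_iff[OF p] by (auto simp: D_def)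
  have ncv: "ncount v j = card (N \<inter> {..j})" if "j \<le> n" for j
  proof -
    have "{l. l < j \<and> v l} = {l. l < j \<and> Suc l \<in> N}" using v that by auto
    then show ?thesis using card_Suc_vimage[OF N] by (simp add: ncount_def)
  qed
  have ncf: "ncount (\<lambda>j. M j = M (Suc j)) j = card (D \<inter> {..<j})" if "j \<le> n" for j
    using flat that by (auto simp: ncount_def intro!: arg_cong[of _ _ card])
  have "code 0 0 0 ?c \<longleftrightarrow>
      (\<forall>j<n. M j \<le> M (Suc j)) \<and> (\<forall>j<Suc n. j \<le> M j) \<and> M n = n \<and>
      (\<forall>j<Suc n. ncount v j \<le> ncount (\<lambda>j. M j = M (Suc j)) j) \<and>
      ncount v n = ncount (\<lambda>j. M j = M (Suc j)) n \<and>
      (\<forall>j<n. M j = M (Suc j) \<longrightarrow> \<not> v j) \<and>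
      (\<forall>j<n. M j \<noteq> M (Suc j) \<longrightarrow> v j \<or> Suc j < n \<and> M (Suc j) = M (Suc (Suc j)))"
    by (simp only: code_iff_index_code[of 0 0] index_code_def Let_def len M_def v_def add_0)
  moreover have "\<forall>j<n. M j \<le> M (Suc j)" using len by (simp add: M prefix_max_Suc)
  moreover have "\<forall>j<Suc n. j \<le> M j" using le_prefix_max[OF p] by (simp add: M)
  moreover have "M n = n" using prefix_max_length[OF p] by (simp add: M)
  moreover have "(\<forall>j<Suc n. ncount v j \<le> ncount (\<lambda>j. M j = M (Suc j)) j) \<longleftrightarrow>
      (\<forall>j\<le>n. card (N \<inter> {..j}) \<le> card (D \<inter> {..<j}))"
    by (simp add: ncv ncf less_Suc_eq_le)
  moreover have "ncount v n = ncount (\<lambda>j. M j = M (Suc j)) n \<longleftrightarrow> card D = card N"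
    using N D_sub by (auto simp: ncv ncf Int_absorb2 subset_iff)
  moreover have "(\<forall>j<n. M j = M (Suc j) \<longrightarrow> \<not> v j) \<longleftrightarrow> N \<inter> Suc ` D = {}"
    using D_sub by (auto simp: v flat)
  \<comment> \<open>A flat step ends in a descent bottom; a rise must end in an NE endpoint or in a
    descent top, the latter meaning that the next step is flat.\<close>
  moreover have "(\<forall>j<n. M j \<noteq> M (Suc j) \<longrightarrow> v j \<or> Suc j < n \<and> M (Suc j) = M (Suc (Suc j))) \<longleftrightarrow>
      {1..n} \<subseteq> D \<union> N \<union> Suc ` D"
  proof -
    have "(\<forall>j<n. M j \<noteq> M (Suc j) \<longrightarrow> v j \<or> Suc j < n \<and> M (Suc j) = M (Suc (Suc j))) \<longleftrightarrow>
        (\<forall>j<n. Suc j \<in> D \<union> N \<union> Suc ` D)"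
    proof -
      have "Suc j < n \<and> M (Suc j) = M (Suc (Suc j)) \<longleftrightarrow> Suc j \<in> D" for j
        using flat[of "Suc j"] D_sub by auto
      then show ?thesis by (auto simp: v flat)
    qed
    also have "\<dots> \<longleftrightarrow> (\<forall>i\<in>Suc ` {..<n}. i \<in> D \<union> N \<union> Suc ` D)" by blast
    also have "Suc ` {..<n} = {1..n}" by (simp add: image_Suc_lessThan)
    finally show ?thesis by (simp only: subset_eq)
  qed
  ultimately show ?thesis by auto
qed

lemma length_filter_vhc_code:
  assumes "p \<in> Av_312 n" "N \<subseteq> {1..n}"
  shows "length (filter snd (vhc_code p N)) = card N"
proof -
  have "length (filter snd (vhc_code p N)) = card {l. l < n \<and> Suc l \<in> N}"
    using Av_312_D(1)[OF assms(1)]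
    by (auto simp: length_filter_conv_card vhc_code_def intro!: arg_cong[of _ _ card])
  also have "\<dots> = card N" using card_Suc_vimage[OF assms(2)] assms(2)
    by (metis Int_absorb2 atLeastAtMost_iff atMost_iff subset_iff)
  finally show ?thesis .
qed

lemma vhc_code_exists:
  assumes c: "code 0 0 0 c" and n: "length c = n"
  obtains p N where "p \<in> Av_312 n" "N \<subseteq> {1..n}" "c = vhc_code p N"
proof -
  define M where "M = (\<lambda>j. (0 # map fst c) ! j)"
  have M: "M 0 = 0" "\<And>j. j < n \<Longrightarrow> M j \<le> M (Suc j)" "\<And>j. j \<le> n \<Longrightarrow> j \<le> M j" "M n = n"
  proof -
    have "index_code 0 0 0 c" using c by (simp add: code_iff_index_code)
    then have "(\<forall>j<n. M j \<le> M (Suc j)) \<and> (\<forall>j<Suc n. j \<le> M j) \<and> M n = n"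
      unfolding index_code_def Let_def M_def n add_0 by blast
    then show "\<And>j. j < n \<Longrightarrow> M j \<le> M (Suc j)" "\<And>j. j \<le> n \<Longrightarrow> j \<le> M j" "M n = n"
      by (simp_all add: less_Suc_eq_le)
  qed (simp add: M_def)
  define p where "p = greedy M n"
  define N where "N = {Suc l | l. l < n \<and> snd (c ! l)}"
  have p: "p \<in> Av_312 n" "\<And>i. i \<le> n \<Longrightarrow> prefix_max p i = M i"
    using greedy_Av_312[of M n] prefix_max_greedy[of M n] M by (simp_all add: p_def)
  have "vhc_code p N = c"
    using n p(2) by (intro nth_equalityI) (auto simp: vhc_code_def p_def N_def M_def prod_eq_iff)
  moreover have "N \<subseteq> {1..n}" by (auto simp: N_def)
  ultimately show thesis using that p(1) by blast
qed

lemma RedVHC_Av_312E: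
  assumes "(p, H) \<in> RedVHC k (Av_312 n)"
  obtains R where "H = lift_hook p ` R" "fst ` snd ` H = snd ` R" "p \<in> Av_312 n" "snd ` R \<subseteq> {1..n}"
    "noncrossing_matching (descents p) (snd ` R) R" "snd ` R \<inter> Suc ` descents p = {}"
    "{1..n} \<subseteq> descents p \<union> snd ` R \<union> Suc ` descents p" "card (snd ` R) = k"
proof -
  have p: "p \<in> Av_312 n" and "H \<subseteq> hooks p"
    using assms by (auto simp: RedVHC_def valid_hook_configuration_def)
  then obtain R where R: "H = lift_hook p ` R" "R \<subseteq> {1..n} \<times> {1..n}"
    using hooks_lift[of H p] Av_312_D(1)[OF p] by metis
  have "fst ` snd ` H = snd ` R" by (simp add: R image_image lift_hook_def)
  moreover have "snd ` R \<subseteq> {1..n}" using R(2) by auto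
  ultimately show thesis
    using that[OF R(1) _ p] RedVHC_lift_iff[OF p R(2), of k] assms unfolding R(1) by blast
qed

text \<open>The prefix maxima determine the permutation, and its descents and the NE endpoints
  determine the hooks as their unique noncrossing matching. Conversely, the greedy permutation and
  the existence of a matching realize every code.\<close>

lemma bij_betw_vhc_code:
  "bij_betw (\<lambda>(p, H). vhc_code p (fst ` snd ` H)) (RedVHC k (Av_312 n))
     {c. code 0 0 0 c \<and> length c = n \<and> length (filter snd c) = k}"
proof -
  have fin: "finite (descents p)" for p
    by (rule finite_subset[of _ "{..length p}"]) (auto simp: descents_def)
  have inj: "p = p' \<and> H = H'"
    if *: "(p, H) \<in> RedVHC k (Av_312 n)" "(p', H') \<in> RedVHC k (Av_312 n)"
      "vhc_code p (fst ` snd ` H) = vhc_code p' (fst ` snd ` H')" for p H p' H'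
  proof -
    obtain R where R: "H = lift_hook p ` R" "fst ` snd ` H = snd ` R" "p \<in> Av_312 n"
      "snd ` R \<subseteq> {1..n}" "noncrossing_matching (descents p) (snd ` R) R" "snd ` R \<inter> Suc ` descents p = {}"
      "{1..n} \<subseteq> descents p \<union> snd ` R \<union> Suc ` descents p" "card (snd ` R) = k"
      by (rule RedVHC_Av_312E[OF *(1)])
    obtain R' where R': "H' = lift_hook p' ` R'" "fst ` snd ` H' = snd ` R'" "p' \<in> Av_312 n"
      "snd ` R' \<subseteq> {1..n}" "noncrossing_matching (descents p') (snd ` R') R'" "snd ` R' \<inter> Suc ` descents p' = {}"
      "{1..n} \<subseteq> descents p' \<union> snd ` R' \<union> Suc ` descents p'" "card (snd ` R') = k"
      by (rule RedVHC_Av_312E[OF *(2)])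
    have len: "length p = n" "length p' = n" using Av_312_D(1)[OF R(3)] Av_312_D(1)[OF R'(3)] by simp_all
    have eq: "prefix_max p (Suc i) = prefix_max p' (Suc i) \<and> (Suc i \<in> snd ` R \<longleftrightarrow> Suc i \<in> snd ` R')"
      if "i < n" for i
      using *(3) that len unfolding R(2) R'(2) vhc_code_def by (simp add: map_eq_conv)
    have "prefix_max p i = prefix_max p' i" if "i \<le> n" for i
      using eq[of "i - 1"] that by (cases i) auto
    then have "p = p'" using prefix_max_inj[OF R(3) R'(3)] by blast
    moreover have "snd ` R = snd ` R'"
    proof -
      have "i \<in> snd ` R \<longleftrightarrow> i \<in> snd ` R'" if "i \<in> {1..n}" for i
        using eq[of "i - 1"] that by (cases i) auto
      then show ?thesis using R(4) R'(4) by blast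
    qed
    moreover have "finite (snd ` R)" using R(4) finite_subset by blast
    ultimately have "R = R'"
      using noncrossing_matching_unique[OF R(5)] R'(5) fin by metis
    then show ?thesis using \<open>p = p'\<close> R(1) R'(1) by simp
  qed
  show ?thesis
    unfolding bij_betw_def
  proof (intro conjI)
    show "inj_on (\<lambda>(p, H). vhc_code p (fst ` snd ` H)) (RedVHC k (Av_312 n))"
    proof (rule inj_onI)
      fix x y
      assume "x \<in> RedVHC k (Av_312 n)" "y \<in> RedVHC k (Av_312 n)"
        "(\<lambda>(p, H). vhc_code p (fst ` snd ` H)) x = (\<lambda>(p, H). vhc_code p (fst ` snd ` H)) y"
      then show "x = y"
        using inj[of "fst x" "snd x" "fst y" "snd y"] by (simp add: case_prod_beta prod_eq_iff)
    qed
    show "(\<lambda>(p, H). vhc_code p (fst ` snd ` H)) ` RedVHC k (Av_312 n) =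
        {c. code 0 0 0 c \<and> length c = n \<and> length (filter snd c) = k}"
    proof (intro equalityI subsetI)
      fix c assume "c \<in> (\<lambda>(p, H). vhc_code p (fst ` snd ` H)) ` RedVHC k (Av_312 n)"
      then obtain p H where *: "(p, H) \<in> RedVHC k (Av_312 n)" "c = vhc_code p (fst ` snd ` H)" by auto
      obtain R where R1: "H = lift_hook p ` R" "fst ` snd ` H = snd ` R" "p \<in> Av_312 n"
        "snd ` R \<subseteq> {1..n}" "noncrossing_matching (descents p) (snd ` R) R" "snd ` R \<inter> Suc ` descents p = {}"
        "{1..n} \<subseteq> descents p \<union> snd ` R \<union> Suc ` descents p" "card (snd ` R) = k"
        by (rule RedVHC_Av_312E[OF *(1)])
      note R = R1(2-8)
      have "code 0 0 0 c"
        unfolding *(2) R(1) code_vhc_code_iff[OF R(2,3)]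
        using R noncrossing_matching_card(2)[OF R(4)] noncrossing_matching_card_le[OF R(4) fin] by simp
      moreover have "length c = n" using *(2) Av_312_D(1)[OF R(2)] by (simp add: vhc_code_def)
      moreover have "length (filter snd c) = k"
        using length_filter_vhc_code[OF R(2,3)] *(2) R(1,7) by simp
      ultimately show "c \<in> {c. code 0 0 0 c \<and> length c = n \<and> length (filter snd c) = k}" by simp
    next
      fix c assume "c \<in> {c. code 0 0 0 c \<and> length c = n \<and> length (filter snd c) = k}"
      then have c: "code 0 0 0 c" "length c = n" "length (filter snd c) = k" by auto
      obtain p N where pN: "p \<in> Av_312 n" "N \<subseteq> {1..n}" "c = vhc_code p N"
        using vhc_code_exists[OF c(1,2)] by blast
      let ?D = "descents p"
      have code: "card ?D = card N" "\<And>j. j \<le> n \<Longrightarrow> card (N \<inter> {..j}) \<le> card (?D \<inter> {..<j})"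
        "N \<inter> Suc ` ?D = {}" "{1..n} \<subseteq> ?D \<union> N \<union> Suc ` ?D"
        using c(1) code_vhc_code_iff[OF pN(1,2)] unfolding pN(3) by blast+
      have D_sub: "?D \<subseteq> {1..n}" using Av_312_D(1)[OF pN(1)] by (auto simp: descents_def)
      have "card (N \<inter> {..j}) \<le> card (?D \<inter> {..<j})" for j
      proof (cases "j \<le> n")
        case False
        then have "N \<inter> {..j} = N \<inter> {..n}" using pN(2) by auto
        then have "card (N \<inter> {..j}) \<le> card (?D \<inter> {..<n})" using code(2)[of n] by simp
        also have "\<dots> \<le> card (?D \<inter> {..<j})" using False fin by (intro card_mono) auto
        finally show ?thesis .
      qed (use code in blast)
      moreover have "finite N" using pN(2) finite_subset by blast
      ultimately obtain R where R: "noncrossing_matching ?D N R"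
        using noncrossing_matching_exists[OF fin _ code(1)] by blast
      then have N: "snd ` R = N" "fst ` R = ?D" by (simp_all add: noncrossing_matching_def)
      have "R \<subseteq> {1..n} \<times> {1..n}"
      proof
        fix r assume "r \<in> R"
        then have "fst r \<in> ?D" "snd r \<in> N" unfolding N[symmetric] by blast+
        then show "r \<in> {1..n} \<times> {1..n}" using D_sub pN(2) by (auto simp: mem_Times_iff)
      qed
      moreover have "card N = k" using length_filter_vhc_code[OF pN(1,2)] c(3) pN(3) by simp
      ultimately have "(p, lift_hook p ` R) \<in> RedVHC k (Av_312 n)"
        using RedVHC_lift_iff[OF pN(1), of R k] R code(3,4) unfolding N by simp
      moreover have "fst ` snd ` lift_hook p ` R = N"
        unfolding N(1)[symmetric] by (simp add: image_image lift_hook_def)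
      ultimately show "c \<in> (\<lambda>(p, H). vhc_code p (fst ` snd ` H)) ` RedVHC k (Av_312 n)"
        using pN(3) by force
    qed
  qed
qed

lemma card_RedVHC_Av_312:
  assumes "i \<le> k"
  shows "card (RedVHC k (Av_312 (3 * k - i))) = (\<Sum>w\<in>dyck_words_3d k. card (Ys_not_after_X w) choose i)"
  using bij_betw_same_card[OF bij_betw_vhc_code, of k "3 * k - i"]
    bij_betw_same_card[OF bij_betw_decode[OF assms]]
    bij_betw_same_card[OF bij_betw_marked_walk, of k i] card_marked_dyck_words[of k i]
  by simp

subsection \<open>The polynomial identity\<close>

text \<open>The binomial theorem; the coefficients beyond \<open>n\<close> vanish, so one bound
  \<open>K\<close> can serve all words.\<close>

lemma sum_monom_choose:
  assumes "n \<le> K"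
  shows "(\<Sum>i = 0..K. monom (int (n choose i)) i) = [:1, 1:] ^ n"
proof -
  have "[:1, 1:] ^ n = (monom 1 1 + 1 :: int poly) ^ n"
    by (simp add: monom_altdef one_pCons)
  also have "\<dots> = (\<Sum>i\<le>n. of_nat (n choose i) * monom 1 i)"
    by (simp add: binomial_ring monom_power)
  also have "\<dots> = (\<Sum>i\<le>n. monom (int (n choose i)) i)"
    by (intro sum.cong) (simp_all add: of_nat_poly mult_monom flip: monom_0)
  also have "\<dots> = (\<Sum>i = 0..K. monom (int (n choose i)) i)"
    using assms by (intro sum.mono_neutral_left) auto
  finally show ?thesis ..
qed

lemma pcompose_power: "pcompose (p ^ n) q = pcompose p q ^ n" for p q :: "'a :: comm_ring_1 poly"
  by (induction n) (simp_all add: pcompose_mult pcompose_1)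

theorem corollary5p1p3:
  fixes k :: nat
  assumes "k \<ge> 1"
  shows "h_poly k = (\<Sum>i = 0..k - 1. monom (int (Duck k i)) i)"
proof -
  let ?W = "dyck_words_3d k" and ?y = "\<lambda>w. card (Ys_not_after_X w)"
  have le: "?y w \<le> k - 1" if "w \<in> ?W" for w
    using card_Ys_not_after_X_less[OF that assms] by simp
  have "f_poly k = (\<Sum>i = 0..k - 1. \<Sum>w\<in>?W. monom (int (?y w choose i)) i)"
    by (simp add: f_poly_def card_RedVHC_Av_312 monom_sum)
  also have "\<dots> = (\<Sum>w\<in>?W. [:1, 1:] ^ ?y w)"
    by (subst sum.swap) (intro sum.cong sum_monom_choose le refl)
  \<comment> \<open>Substituting \<open>x - 1\<close> turns \<open>1 + x\<close> into
    \<open>x\<close>, so each word contributes a single monomial.\<close>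
  finally have "h_poly k = (\<Sum>w\<in>?W. pcompose [:1, 1:] [:- 1, 1:] ^ ?y w)"
    by (simp add: h_poly_def pcompose_sum pcompose_power)
  also have "\<dots> = (\<Sum>w\<in>?W. monom 1 (?y w))"
    by (simp add: pcompose_pCons monom_altdef)
  \<comment> \<open>Grouping by the exponent loses no word, as \<open>le\<close> bounds it by
    \<open>k - 1\<close>.\<close>
  also have "\<dots> = (\<Sum>i = 0..k - 1. \<Sum>w\<in>{w \<in> ?W. ?y w = i}. monom 1 (?y w))"
    by (intro sum.group[symmetric]) (auto simp: finite_dyck_words_3d le simp del: One_nat_def)
  also have "\<dots> = (\<Sum>i = 0..k - 1. monom (int (Duck k i)) i)"
    by (intro sum.cong) (auto simp: Duck_def of_nat_poly mult_monom simp flip: monom_0)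
  finally show ?thesis .
qed

end
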